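(* Let $F:\mathbb{R}^m\to\mathbb{R}^m$ be a continuously differentiable mapping. Assume that for every sequence $\{x^k\}\subset\mathbb{R}^m$, if $\{\|F(x^k)\|\}$ is bounded, then $\{\|x^k\|\}$ is also bounded. Assume further that $|\nabla F(x)|\neq 0$ for every $x\in\mathbb{R}^m$ with $F(x)\neq 0$. Then the variational inequality problem VI$(\mathbb{R}^m,F)$ has a solution.
   Context: $\nabla F(x)$ denotes the Jacobian matrix of $F$ at $x$, and $|\nabla F(x)|$ denotes its determinant. For a set $K\subseteq\mathbb{R}^m$ and a mapping $F:K\to\mathbb{R}^m$, a solution of VI$(K,F)$ is a point $x^*\in K$ such that $\langle F(x^* ),x-x^*\rangle\ge 0$ for all $x\in K$. *)

theory Defs
  imports "HOL-Analysis.Analysis"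
begin

definition VI_solution ::
    "'a::real_inner set \<Rightarrow> ('a \<Rightarrow> 'a) \<Rightarrow> 'a \<Rightarrow> bool" where
  "VI_solution K F x \<longleftrightarrow> x \<in> K \<and> (\<forall>y\<in>K. F x \<bullet> (y - x) \<ge> 0)"

definition continuously_differentiable ::
    "(real ^ 'm \<Rightarrow> real ^ 'n) \<Rightarrow> bool" where
  "continuously_differentiable F \<longleftrightarrow>
     (\<forall>x. F differentiable (at x)) \<and> continuous_on UNIV (\<lambda>x. jacobian F (at x))"

end

(* A nonnegative function \<parallel>F\<parallel>\<^sup>2 with bounded sublevel sets attains its minimum at some x. Its derivative
   h \<mapsto> 2 (F x \<bullet> J h) vanishes there, so an invertible Jacobian J would force F x = 0, while
   a singular one gives F x = 0 by hypothesis; a zero of F solves the variational inequality. *)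
theory Submission
  imports Defs
begin

text \<open>An unbounded sublevel set would contain points of arbitrarily large norm; a sequence of
  them escapes to infinity while \<open>F\<close> stays bounded along it, which coercivity
  forbids.\<close>

lemma bounded_sublevel_if_sequentially_coercive:
  fixes F :: "'a::real_normed_vector \<Rightarrow> 'b::real_normed_vector"
  assumes coercive: "\<And>X :: nat \<Rightarrow> 'a.
      bounded (range (\<lambda>k. norm (F (X k)))) \<Longrightarrow> bounded (range (\<lambda>k. norm (X k)))"
  shows "bounded {x. norm (F x) \<le> c}"
proof (rule ccontr)
  assume "\<not> bounded {x. norm (F x) \<le> c}"
  then have "\<exists>x. norm (F x) \<le> c \<and> norm x > real k" for k
    unfolding bounded_iff by (metis mem_Collect_eq not_less)
  then obtain X where X: "\<And>k. norm (F (X k)) \<le> c" "\<And>k. norm (X k) > real k"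
    by metis
  have "bounded (range (\<lambda>k. norm (F (X k))))"
    using X(1) by (auto simp: bounded_iff)
  then obtain B where B: "\<And>k. norm (X k) \<le> B"
    using coercive[of X] by (auto simp: bounded_iff)
  obtain k where "B \<le> real k"
    using real_arch_simple by blast
  with B[of k] X(2)[of k] show False
    by linarith
qed

text \<open>In finite dimension the sublevel set through 0 is compact and nonempty, so the extreme
  value theorem applies there.\<close>

lemma continuous_attains_min_norm:
  fixes F :: "'a::euclidean_space \<Rightarrow> 'b::real_normed_vector"
  assumes cont: "continuous_on UNIV F"
    and bounded: "\<And>c. bounded {x. norm (F x) \<le> c}"
  obtains x where "\<And>y. norm (F x) \<le> norm (F y)"
proof -
  let ?S = "{x. norm (F x) \<le> norm (F 0)}"
  have "closed ?S"
    by (intro closed_Collect_le continuous_on_norm cont continuous_on_const)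
  then have "compact ?S"
    using bounded compact_eq_bounded_closed by blast
  moreover have "?S \<noteq> {}"
    by blast
  moreover have "continuous_on ?S (\<lambda>x. norm (F x))"
    by (intro continuous_on_norm continuous_on_subset[OF cont]) simp
  ultimately obtain x where "x \<in> ?S" and min: "\<And>y. y \<in> ?S \<Longrightarrow> norm (F x) \<le> norm (F y)"
    using continuous_attains_inf[of ?S "\<lambda>x. norm (F x)"] by blast
  \<comment> \<open>The minimum over \<open>?S\<close> is global: for \<open>y\<close> outside
    \<open>?S\<close>, the value at \<open>y\<close> exceeds \<open>norm (F 0)\<close>, which bounds
    the value at \<open>x\<close>.\<close>
  have "norm (F x) \<le> norm (F y)" for y
    using \<open>x \<in> ?S\<close> min[of y] unfolding mem_Collect_eq by linarith
  then show thesis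
    by (rule that)
qed

lemma min_norm_surj_derivative_zero:
  fixes F :: "'a::real_normed_vector \<Rightarrow> 'b::real_inner"
  assumes deriv: "(F has_derivative F') (at x)"
    and min: "\<And>y. norm (F x) \<le> norm (F y)"
    and "surj F'"
  shows "F x = 0"
proof -
  \<comment> \<open>The norm is squared because the norm itself may fail to be differentiable at a
    zero of \<open>F\<close>; squaring keeps the same minimizers.\<close>
  have "((\<lambda>y. F y \<bullet> F y) has_derivative (\<lambda>h. F x \<bullet> F' h + F' h \<bullet> F x)) (at x)"
    by (intro has_derivative_inner deriv)
  moreover have "F x \<bullet> F x \<le> F y \<bullet> F y" for y
    using min[of y] by (simp add: norm_le)
  ultimately have "(\<lambda>h. F x \<bullet> F' h + F' h \<bullet> F x) = (\<lambda>h. 0)"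
    by (intro differential_zero_maxmin[of x UNIV]) auto
  then have "F x \<bullet> F' h = 0" for h
    by (simp add: fun_eq_iff inner_commute)
  \<comment> \<open>Choosing \<open>h\<close> with \<open>F' h = F x\<close> makes
    \<open>F x\<close> orthogonal to itself.\<close>
  with \<open>surj F'\<close> show ?thesis
    by (metis inner_eq_zero_iff surjD)
qed

theorem theorem6:
  fixes F :: "real ^ 'm \<Rightarrow> real ^ 'm"
  assumes C1: "continuously_differentiable F"
    and coercive: "\<And>X :: nat \<Rightarrow> real ^ 'm.
      bounded (range (\<lambda>k. norm (F (X k)))) \<Longrightarrow> bounded (range (\<lambda>k. norm (X k)))"
    and nonsingular: "\<And>x. F x \<noteq> 0 \<Longrightarrow> det (jacobian F (at x)) \<noteq> 0"
  shows "\<exists>x. VI_solution UNIV F x"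
proof -
  have diff: "F differentiable (at x)" for x
    using C1 by (simp add: continuously_differentiable_def)
  then have "continuous_on UNIV F"
    by (simp add: continuous_at_imp_continuous_on differentiable_imp_continuous_within)
  then obtain x where min: "\<And>y. norm (F x) \<le> norm (F y)"
    using continuous_attains_min_norm bounded_sublevel_if_sequentially_coercive[OF coercive]
    by metis
  have "F x = 0"
  proof (rule ccontr)
    let ?J = "jacobian F (at x)"
    assume "F x \<noteq> 0"
    then have "invertible ?J"
      using nonsingular invertible_det_nz by blast
    \<comment> \<open>A right inverse of \<open>?J\<close> supplies a preimage for every vector, in
      particular for \<open>F x\<close>.\<close>
    then have "surj ((*v) ?J)"
      by (metis invertible_right_inverse matrix_right_invertible_surjective)
    moreover have "(F has_derivative (*v) ?J) (at x)"
      using diff jacobian_works by blast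
    ultimately show False
      using min_norm_surj_derivative_zero min \<open>F x \<noteq> 0\<close> by blast
  qed
  then have "VI_solution UNIV F x"
    by (simp add: VI_solution_def)
  then show ?thesis ..
qed

end
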